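(* Let $a,b$ be positive integers, let $J$ be a metallic structure on a smooth manifold $M_n$ (that is, $J^2=aJ+bI$), with associated projectors $l,m$ and distributions $L,M$, let $\nabla$ be a linear connection on $M_n$, and let $\hat\nabla$ be the Vrănceanu connection of $(J,\nabla)$. If $[lX,mY]\in L$ for all $X\in L$ and $Y\in\chi(M_n)$, then the distribution $L$ is half parallel with respect to $\hat\nabla$.
   Context: All manifolds and tensor fields are $C^\infty$; $\chi(M_n)$ is the Lie algebra of vector fields on the $n$-dimensional manifold $M_n$ and $I$ is the identity; $X\in L$ means $X$ is a vector field that is a section of $L$. For positive integers $a,b$, a metallic structure is a $(1,1)$-tensor field $J$ with $J^2=aJ+bI$, and $\rho_{a,b}=\frac{a+\sqrt{a^2+4b}}{2}$. $L$ and $M$ are the complementary eigendistributions of $J$ for the eigenvalues $\rho_{a,b}$ and $a-\rho_{a,b}$ respectively, with projectors $l=\frac{1}{2\rho_{a,b}-a}J-\frac{a-\rho_{a,b}}{2\rho_{a,b}-a}I$ and $m=-\frac{1}{2\rho_{a,b}-a}J+\frac{\rho_{a,b}}{2\rho_{a,b}-a}I$. The Vrănceanu connection is $\hat\nabla_XY=l(\nabla_{lX}lY)+m(\nabla_{mX}mY)+l[mX,lY]+m[lX,mY]$. For a linear connection $D$ put $(\Delta J)(X,Y)=J D_XY-J D_YX-D_{JX}Y+D_Y(JX)$. The distribution $L$ is called half parallel with respect to $D$ if $(\Delta J)(X,Y)\in L$ for all $X\in L$, $Y\in\chi(M_n)$. *)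

theory Defs
  imports "HOL-Analysis.Analysis" "HOL-Library.Function_Algebras"
begin

subsection \<open>Smooth manifolds\<close>

text \<open>Used for open \<open>S\<close> only. \<open>C_k_on k S f\<close>: the function \<open>f\<close> is of class \<open>C^k\<close> on \<open>S\<close>,
  by recursion on its directional derivatives.\<close>

primrec C_k_on ::
  "nat \<Rightarrow> 'b::real_normed_vector set \<Rightarrow> ('b \<Rightarrow> 'c::real_normed_vector) \<Rightarrow> bool" where
  "C_k_on 0 S f \<longleftrightarrow> continuous_on S f"
| "C_k_on (Suc k) S f \<longleftrightarrow>
     (\<forall>x\<in>S. f differentiable (at x)) \<and>
     (\<forall>v. C_k_on k S (\<lambda>x. frechet_derivative f (at x) v))"

definition smooth_on ::
  "'b::real_normed_vector set \<Rightarrow> ('b \<Rightarrow> 'c::real_normed_vector) \<Rightarrow> bool" where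
  "smooth_on S f \<longleftrightarrow> (\<forall>k. C_k_on k S f)"

text \<open>A chart is a domain together with a coordinate map, whose values off the domain are
  irrelevant. The manifold is the whole type \<open>'a\<close>; the class constraints in
  \<open>smooth_atlas\<close> make it Hausdorff and second countable.\<close>

type_synonym ('a, 'n) chart = "'a set \<times> ('a \<Rightarrow> real^'n)"
type_synonym ('a, 'n) atlas = "('a, 'n) chart set"

definition smooth_atlas ::
  "('a::{t2_space, second_countable_topology}, 'n::finite) atlas \<Rightarrow> bool" where
  "smooth_atlas \<A> \<longleftrightarrow>
     (\<forall>(U, \<phi>)\<in>\<A>. open U \<and> open (\<phi> ` U) \<and> homeomorphism U (\<phi> ` U) \<phi> (inv_into U \<phi>)) \<and>
     (\<Union>(U, \<phi>)\<in>\<A>. U) = UNIV \<and>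
     (\<forall>(U, \<phi>)\<in>\<A>. \<forall>(V, \<psi>)\<in>\<A>. smooth_on (\<phi> ` (U \<inter> V)) (\<psi> \<circ> inv_into U \<phi>))"

definition C_inf :: "('a, 'n::finite) atlas \<Rightarrow> ('a \<Rightarrow> real) set" where
  "C_inf \<A> = {f. \<forall>(U, \<phi>)\<in>\<A>. smooth_on (\<phi> ` U) (f \<circ> inv_into U \<phi>)}"

subsection \<open>Tangent vectors, vector fields, tensor fields of type (1,1)\<close>

text \<open>Sums, differences and products of functions are pointwise (\<open>Function_Algebras\<close>), both for
  real functions on the manifold and for tangent vectors and vector fields.
  Tangent vectors are derivations of \<open>C_inf \<A>\<close>; as HOL functions are total, they are
  made to vanish outside \<open>C_inf \<A>\<close> so that equality of derivations is equality of functions.\<close>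

type_synonym 'a tvec = "('a \<Rightarrow> real) \<Rightarrow> real"
type_synonym 'a vfield = "'a \<Rightarrow> 'a tvec"
type_synonym 'a tensor11 = "'a \<Rightarrow> 'a tvec \<Rightarrow> 'a tvec"

definition scale_tvec :: "real \<Rightarrow> 'a tvec \<Rightarrow> 'a tvec"  (infixr "*\<^sub>t" 75) where
  "c *\<^sub>t v = (\<lambda>f. c * v f)"

definition tangent_space :: "('a, 'n::finite) atlas \<Rightarrow> 'a \<Rightarrow> 'a tvec set" where
  "tangent_space \<A> p = {v.
     (\<forall>f\<in>C_inf \<A>. \<forall>g\<in>C_inf \<A>. v (f + g) = v f + v g) \<and>
     (\<forall>f\<in>C_inf \<A>. \<forall>c. v (\<lambda>q. c * f q) = c * v f) \<and>
     (\<forall>f\<in>C_inf \<A>. \<forall>g\<in>C_inf \<A>. v (f * g) = f p * v g + g p * v f) \<and>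
     (\<forall>f. f \<notin> C_inf \<A> \<longrightarrow> v f = 0)}"

definition vector_fields :: "('a, 'n::finite) atlas \<Rightarrow> 'a vfield set" where
  "vector_fields \<A> = {X.
     (\<forall>p. X p \<in> tangent_space \<A> p) \<and> (\<forall>f\<in>C_inf \<A>. (\<lambda>p. X p f) \<in> C_inf \<A>)}"

definition scale_vfield :: "('a \<Rightarrow> real) \<Rightarrow> 'a vfield \<Rightarrow> 'a vfield"  (infixr "*\<^sub>v" 75) where
  "f *\<^sub>v X = (\<lambda>p. f p *\<^sub>t X p)"

text \<open>For vector fields \<open>X\<close>, \<open>Y\<close> the bracket again vanishes on non-smooth functions,
  so no case distinction is needed.\<close>

definition lie_bracket :: "'a vfield \<Rightarrow> 'a vfield \<Rightarrow> 'a vfield" where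
  "lie_bracket X Y = (\<lambda>p f. X p (\<lambda>q. Y q f) - Y p (\<lambda>q. X q f))"

definition apply_tensor :: "'a tensor11 \<Rightarrow> 'a vfield \<Rightarrow> 'a vfield"  (infixr "\<bullet>\<^sub>T" 80) where
  "J \<bullet>\<^sub>T X = (\<lambda>p. J p (X p))"

text \<open>A field of endomorphisms of the tangent spaces is smooth if it maps smooth vector
  fields to smooth vector fields.\<close>

definition tensor_field11 :: "('a, 'n::finite) atlas \<Rightarrow> 'a tensor11 \<Rightarrow> bool" where
  "tensor_field11 \<A> J \<longleftrightarrow>
     (\<forall>p. \<forall>v\<in>tangent_space \<A> p. J p v \<in> tangent_space \<A> p \<and>
        (\<forall>w\<in>tangent_space \<A> p. J p (v + w) = J p v + J p w) \<and>
        (\<forall>c. J p (c *\<^sub>t v) = c *\<^sub>t J p v)) \<and>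
     (\<forall>X\<in>vector_fields \<A>. J \<bullet>\<^sub>T X \<in> vector_fields \<A>)"

subsection \<open>Metallic structures and their distributions\<close>

definition metallic_structure ::
  "('a, 'n::finite) atlas \<Rightarrow> nat \<Rightarrow> nat \<Rightarrow> 'a tensor11 \<Rightarrow> bool" where
  "metallic_structure \<A> a b J \<longleftrightarrow> tensor_field11 \<A> J \<and>
     (\<forall>p. \<forall>v\<in>tangent_space \<A> p. J p (J p v) = real a *\<^sub>t J p v + real b *\<^sub>t v)"

definition metallic_mean :: "nat \<Rightarrow> nat \<Rightarrow> real" where
  "metallic_mean a b = (real a + sqrt (real a ^ 2 + 4 * real b)) / 2"

definition eigendistribution ::
  "('a, 'n::finite) atlas \<Rightarrow> 'a tensor11 \<Rightarrow> real \<Rightarrow> 'a \<Rightarrow> 'a tvec set" where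
  "eigendistribution \<A> J c p = {v\<in>tangent_space \<A> p. J p v = c *\<^sub>t v}"

definition dist_L ::
  "('a, 'n::finite) atlas \<Rightarrow> nat \<Rightarrow> nat \<Rightarrow> 'a tensor11 \<Rightarrow> 'a \<Rightarrow> 'a tvec set" where
  "dist_L \<A> a b J = eigendistribution \<A> J (metallic_mean a b)"

definition dist_M ::
  "('a, 'n::finite) atlas \<Rightarrow> nat \<Rightarrow> nat \<Rightarrow> 'a tensor11 \<Rightarrow> 'a \<Rightarrow> 'a tvec set" where
  "dist_M \<A> a b J = eigendistribution \<A> J (real a - metallic_mean a b)"

definition sections ::
  "('a, 'n::finite) atlas \<Rightarrow> ('a \<Rightarrow> 'a tvec set) \<Rightarrow> 'a vfield set" where
  "sections \<A> L = {X\<in>vector_fields \<A>. \<forall>p. X p \<in> L p}"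

definition proj_l :: "nat \<Rightarrow> nat \<Rightarrow> 'a tensor11 \<Rightarrow> 'a tensor11" where
  "proj_l a b J = (let \<rho> = metallic_mean a b in
     (\<lambda>p v. (1 / (2 * \<rho> - real a)) *\<^sub>t J p v - ((real a - \<rho>) / (2 * \<rho> - real a)) *\<^sub>t v))"

definition proj_m :: "nat \<Rightarrow> nat \<Rightarrow> 'a tensor11 \<Rightarrow> 'a tensor11" where
  "proj_m a b J = (let \<rho> = metallic_mean a b in
     (\<lambda>p v. (- 1 / (2 * \<rho> - real a)) *\<^sub>t J p v + (\<rho> / (2 * \<rho> - real a)) *\<^sub>t v))"

subsection \<open>Linear connections\<close>

definition linear_connection ::
  "('a, 'n::finite) atlas \<Rightarrow> ('a vfield \<Rightarrow> 'a vfield \<Rightarrow> 'a vfield) \<Rightarrow> bool" where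
  "linear_connection \<A> D \<longleftrightarrow>
     (\<forall>X\<in>vector_fields \<A>. \<forall>Y\<in>vector_fields \<A>.
        D X Y \<in> vector_fields \<A> \<and>
        (\<forall>Z\<in>vector_fields \<A>. D (X + Z) Y = D X Y + D Z Y \<and> D X (Y + Z) = D X Y + D X Z) \<and>
        (\<forall>f\<in>C_inf \<A>. D (f *\<^sub>v X) Y = f *\<^sub>v D X Y \<and>
           D X (f *\<^sub>v Y) = f *\<^sub>v D X Y + (\<lambda>p. X p f) *\<^sub>v Y))"

definition vranceanu ::
  "nat \<Rightarrow> nat \<Rightarrow> 'a tensor11 \<Rightarrow> ('a vfield \<Rightarrow> 'a vfield \<Rightarrow> 'a vfield) \<Rightarrow>
   'a vfield \<Rightarrow> 'a vfield \<Rightarrow> 'a vfield" where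
  "vranceanu a b J D X Y = (let l = proj_l a b J; m = proj_m a b J in
     l \<bullet>\<^sub>T D (l \<bullet>\<^sub>T X) (l \<bullet>\<^sub>T Y) + m \<bullet>\<^sub>T D (m \<bullet>\<^sub>T X) (m \<bullet>\<^sub>T Y)
     + l \<bullet>\<^sub>T lie_bracket (m \<bullet>\<^sub>T X) (l \<bullet>\<^sub>T Y) + m \<bullet>\<^sub>T lie_bracket (l \<bullet>\<^sub>T X) (m \<bullet>\<^sub>T Y))"

definition Delta ::
  "'a tensor11 \<Rightarrow> ('a vfield \<Rightarrow> 'a vfield \<Rightarrow> 'a vfield) \<Rightarrow>
   'a vfield \<Rightarrow> 'a vfield \<Rightarrow> 'a vfield" where
  "Delta J D X Y = J \<bullet>\<^sub>T D X Y - J \<bullet>\<^sub>T D Y X - D (J \<bullet>\<^sub>T X) Y + D Y (J \<bullet>\<^sub>T X)"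

definition half_parallel ::
  "('a, 'n::finite) atlas \<Rightarrow> 'a tensor11 \<Rightarrow> ('a vfield \<Rightarrow> 'a vfield \<Rightarrow> 'a vfield) \<Rightarrow>
   ('a \<Rightarrow> 'a tvec set) \<Rightarrow> bool" where
  "half_parallel \<A> J D L \<longleftrightarrow>
     (\<forall>X\<in>sections \<A> L. \<forall>Y\<in>vector_fields \<A>. Delta J D X Y \<in> sections \<A> L)"

end

theory Submission
  imports Defs
begin

text \<open>
  Write \<open>V\<close> for the Vranceanu connection of \<open>(J, D)\<close>. Let \<open>X\<close> be a section of \<open>L\<close> and \<open>Y\<close> any
  vector field. Then \<open>l X = X\<close> and \<open>m X = 0\<close>, so every term of \<open>V\<close> that contains \<open>m X\<close> drops out,
  which leaves

    \<open>V X Y = l (D X (l Y)) + m [X, m Y]\<close>  and  \<open>V Y X = l (D (l Y) X) + l [m Y, X]\<close>.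

  All summands are in the range of \<open>l\<close>, that is, in \<open>L\<close>, except \<open>m [X, m Y]\<close>, and this one vanishes
  exactly because \<open>[l X, m Y] = [X, m Y]\<close> is assumed to lie in \<open>L\<close>
  (\<open>vranceanu_along_section\<close>, \<open>vranceanu_of_section\<close>). Since \<open>J\<close> acts on \<open>L\<close> as a scalar, \<open>J X\<close> is
  again a section of \<open>L\<close>, hence all four terms of \<open>Delta J V X Y\<close> are sections of \<open>L\<close>, and so is
  their sum.

  Being a section includes being smooth. That \<open>l X\<close> and \<open>m X\<close> are smooth rests on the smooth functions
  forming a real vector space (\<open>C_inf_lincomb\<close>). Smoothness of brackets would in general require
  that they also form a ring, but the only bracket involved is \<open>[m Y, X] = - [X, m Y]\<close>, which the
  hypothesis already places among the sections of \<open>L\<close>.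
\<close>

section \<open>Linear combinations of smooth functions and of vector fields\<close>

text \<open>The derivatives in the recursion are those of the functions on the whole space, so agreement
  on \<open>S\<close> is enough only because \<open>S\<close> is a neighbourhood of each of its points.\<close>

lemma C_k_on_cong:
  assumes "open S" "\<And>x. x \<in> S \<Longrightarrow> f x = g x" "C_k_on k S f"
  shows "C_k_on k S g"
  using assms(2,3)
proof (induction k arbitrary: f g)
  case 0
  then show ?case
    using continuous_on_cong[of S S f g] by simp
next
  case (Suc k)
  have deriv: "(g has_derivative frechet_derivative f (at x)) (at x)" if "x \<in> S" for x
  proof (rule has_derivative_transform_within_open[OF _ assms(1) that Suc.prems(1)])
    show "(f has_derivative frechet_derivative f (at x)) (at x)"
      using Suc.prems(2) that by (simp add: frechet_derivative_works)
  qed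
  have "C_k_on k S (\<lambda>x. frechet_derivative g (at x) v)" for v
  proof (rule Suc.IH)
    show "frechet_derivative f (at x) v = frechet_derivative g (at x) v" if "x \<in> S" for x
      using frechet_derivative_at[OF deriv[OF that]] by simp
    show "C_k_on k S (\<lambda>x. frechet_derivative f (at x) v)"
      using Suc.prems(2) by simp
  qed
  moreover have "g differentiable (at x)" if "x \<in> S" for x
    using deriv[OF that] by (auto simp: differentiable_def)
  ultimately show ?case by simp
qed

lemma C_k_on_lincomb:
  assumes "open S" "C_k_on k S f" "C_k_on k S g"
  shows "C_k_on k S (\<lambda>x. c *\<^sub>R f x + d *\<^sub>R g x)"
  using assms(2,3)
proof (induction k arbitrary: f g)
  case 0
  then show ?case by (auto intro!: continuous_intros)
next
  case (Suc k)
  let ?h = "\<lambda>x. c *\<^sub>R f x + d *\<^sub>R g x"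
  have deriv: "(?h has_derivative
      (\<lambda>v. c *\<^sub>R frechet_derivative f (at x) v + d *\<^sub>R frechet_derivative g (at x) v)) (at x)"
    if "x \<in> S" for x
    using Suc.prems that
    by (auto intro!: derivative_intros simp: frechet_derivative_works[symmetric])
  have "C_k_on k S (\<lambda>x. frechet_derivative ?h (at x) v)" for v
  proof (rule C_k_on_cong[OF assms(1)])
    show "c *\<^sub>R frechet_derivative f (at x) v + d *\<^sub>R frechet_derivative g (at x) v
        = frechet_derivative ?h (at x) v" if "x \<in> S" for x
      by (simp flip: frechet_derivative_at[OF deriv[OF that]])
    show "C_k_on k S
        (\<lambda>x. c *\<^sub>R frechet_derivative f (at x) v + d *\<^sub>R frechet_derivative g (at x) v)"
      using Suc.prems by (intro Suc.IH) auto
  qed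
  moreover have "?h differentiable (at x)" if "x \<in> S" for x
    using deriv[OF that] by (auto simp: differentiable_def)
  ultimately show ?case by simp
qed

lemma C_inf_lincomb:
  assumes "smooth_atlas \<A>" "f \<in> C_inf \<A>" "g \<in> C_inf \<A>"
  shows "(\<lambda>p. c * f p + d * g p) \<in> C_inf \<A>"
  unfolding C_inf_def smooth_on_def
proof (clarify)
  fix U \<phi> k assume U: "(U, \<phi>) \<in> \<A>"
  have "open (\<phi> ` U)" "C_k_on k (\<phi> ` U) (f \<circ> inv_into U \<phi>)" "C_k_on k (\<phi> ` U) (g \<circ> inv_into U \<phi>)"
    using assms U by (auto simp: smooth_atlas_def C_inf_def smooth_on_def)
  from C_k_on_lincomb[OF this, of c d]
  show "C_k_on k (\<phi> ` U) ((\<lambda>p. c * f p + d * g p) \<circ> inv_into U \<phi>)"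
    by (simp add: o_def)
qed

lemma tangent_space_lincomb:
  assumes "v \<in> tangent_space \<A> p" "w \<in> tangent_space \<A> p"
  shows "c *\<^sub>t v + d *\<^sub>t w \<in> tangent_space \<A> p"
  using assms unfolding tangent_space_def scale_tvec_def
  by (simp add: algebra_simps)

lemma vector_fields_lincomb:
  assumes "smooth_atlas \<A>" "X \<in> vector_fields \<A>" "Y \<in> vector_fields \<A>"
  shows "(\<lambda>p. c *\<^sub>t X p + d *\<^sub>t Y p) \<in> vector_fields \<A>"
  using assms tangent_space_lincomb[of _ \<A>] C_inf_lincomb[OF assms(1)]
  by (simp add: vector_fields_def scale_tvec_def)

text \<open>Derivations kill the zero function whether or not it counts as smooth, because they vanish
  on functions outside \<open>C_inf\<close> by convention.\<close>

lemma tangent_space_zero_fun: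
  assumes "v \<in> tangent_space \<A> p"
  shows "v (\<lambda>q. 0) = 0"
proof (cases "(\<lambda>q. 0) \<in> C_inf \<A>")
  case True
  moreover have "\<forall>f\<in>C_inf \<A>. \<forall>c. v (\<lambda>q. c * f q) = c * v f"
    using assms by (simp add: tangent_space_def)
  ultimately have "v (\<lambda>q. 0 * 0) = 0 * v (\<lambda>q. 0)" by fast
  then show ?thesis by simp
next
  case False
  then show ?thesis using assms by (simp add: tangent_space_def)
qed

lemma lie_bracket_zero_left:
  assumes "Y \<in> vector_fields \<A>"
  shows "lie_bracket 0 Y = 0"
  using assms tangent_space_zero_fun[of _ \<A>]
  by (auto simp: lie_bracket_def vector_fields_def fun_eq_iff)

lemma lie_bracket_anticommute: "lie_bracket X Y = - lie_bracket Y X"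
  by (simp add: lie_bracket_def fun_eq_iff)

lemma linear_connection_zero:
  assumes "linear_connection \<A> D" "0 \<in> vector_fields \<A>" "Y \<in> vector_fields \<A>"
  shows "D 0 Y = 0" "D Y 0 = 0"
proof -
  have "D (0 + 0) Y = D 0 Y + D 0 Y" "D Y (0 + 0) = D Y 0 + D Y 0"
    using assms unfolding linear_connection_def by blast+
  then show "D 0 Y = 0" "D Y 0 = 0" by simp_all
qed

section \<open>The projectors of a metallic structure\<close>

lemma metallic_mean_equation: "metallic_mean a b ^ 2 = real a * metallic_mean a b + real b"
proof -
  have "sqrt (real a ^ 2 + 4 * real b) ^ 2 = real a ^ 2 + 4 * real b" by simp
  then show ?thesis
    unfolding metallic_mean_def by (simp add: power2_eq_square field_simps)
qed

lemma metallic_mean_eigenvalue_gap: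
  assumes "b > 0"
  shows "2 * metallic_mean a b - real a > 0"
  using assms by (simp add: metallic_mean_def add_nonneg_pos)

locale metallic_manifold =
  fixes \<A> :: "('a::{t2_space, second_countable_topology}, 'n::finite) atlas"
    and a b :: nat and J :: "'a tensor11"
  assumes atlas: "smooth_atlas \<A>"
    and b_pos: "b > 0"
    and metallic: "metallic_structure \<A> a b J"
begin

abbreviation "l \<equiv> proj_l a b J"
abbreviation "m \<equiv> proj_m a b J"
abbreviation "L \<equiv> dist_L \<A> a b J"
abbreviation "VF \<equiv> vector_fields \<A>"
abbreviation "\<Gamma>L \<equiv> sections \<A> L"

lemma J_tangent: "v \<in> tangent_space \<A> p \<Longrightarrow> J p v \<in> tangent_space \<A> p"
  using metallic unfolding metallic_structure_def tensor_field11_def by blast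

lemma J_scale: "v \<in> tangent_space \<A> p \<Longrightarrow> J p (c *\<^sub>t v) = c *\<^sub>t J p v"
  using metallic unfolding metallic_structure_def tensor_field11_def by blast

lemma scale_tangent: "v \<in> tangent_space \<A> p \<Longrightarrow> c *\<^sub>t v \<in> tangent_space \<A> p"
  by (simp add: tangent_space_def scale_tvec_def algebra_simps)

lemma J_lincomb:
  assumes "v \<in> tangent_space \<A> p" "w \<in> tangent_space \<A> p"
  shows "J p (c *\<^sub>t v + d *\<^sub>t w) = c *\<^sub>t J p v + d *\<^sub>t J p w"
proof -
  have "J p (c *\<^sub>t v + d *\<^sub>t w) = J p (c *\<^sub>t v) + J p (d *\<^sub>t w)"
    using metallic scale_tangent[OF assms(1)] scale_tangent[OF assms(2)]
    unfolding metallic_structure_def tensor_field11_def by blast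
  then show ?thesis using assms by (simp add: J_scale)
qed

lemma J_square: "v \<in> tangent_space \<A> p \<Longrightarrow> J p (J p v) = real a *\<^sub>t J p v + real b *\<^sub>t v"
  using metallic unfolding metallic_structure_def by blast

lemma J_vector_field: "X \<in> VF \<Longrightarrow> J \<bullet>\<^sub>T X \<in> VF"
  using metallic unfolding metallic_structure_def tensor_field11_def by blast

lemma proj_l_lincomb:
  "l p v = (1 / (2 * metallic_mean a b - real a)) *\<^sub>t J p v
         + (- (real a - metallic_mean a b) / (2 * metallic_mean a b - real a)) *\<^sub>t v"
  by (simp add: proj_l_def Let_def scale_tvec_def fun_eq_iff left_diff_distrib diff_divide_distrib)

lemma proj_m_vector_field:
  assumes "X \<in> VF"
  shows "m \<bullet>\<^sub>T X \<in> VF"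
  using vector_fields_lincomb[OF atlas J_vector_field[OF assms] assms]
  by (simp only: proj_m_def apply_tensor_def Let_def)

text \<open>With \<open>\<rho>\<close> the metallic mean, \<open>J l v = \<rho> l v\<close> because \<open>\<rho>\<close> and \<open>a - \<rho>\<close> are the two roots of
  the polynomial that \<open>J\<close> satisfies and \<open>l\<close> is a multiple of \<open>J - (a - \<rho>) I\<close>.\<close>

lemma proj_l_in_L:
  assumes "v \<in> tangent_space \<A> p"
  shows "l p v \<in> L p"
proof -
  let ?\<rho> = "metallic_mean a b"
  let ?s = "2 * ?\<rho> - real a"
  have "J p (l p v) = (1 / ?s) *\<^sub>t J p (J p v) + (- (real a - ?\<rho>) / ?s) *\<^sub>t J p v"
    unfolding proj_l_lincomb using assms by (intro J_lincomb J_tangent)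
  also have "\<dots> = (1 / ?s) *\<^sub>t (?\<rho> *\<^sub>t J p v + real b *\<^sub>t v)"
    by (simp add: J_square[OF assms] scale_tvec_def fun_eq_iff algebra_simps
        add_divide_distrib diff_divide_distrib)
  also have "real b = ?\<rho> * (- (real a - ?\<rho>))"
    using metallic_mean_equation[of a b] by (simp add: power2_eq_square algebra_simps)
  also have "(1 / ?s) *\<^sub>t (?\<rho> *\<^sub>t J p v + (?\<rho> * (- (real a - ?\<rho>))) *\<^sub>t v) = ?\<rho> *\<^sub>t l p v"
    by (simp add: proj_l_lincomb scale_tvec_def fun_eq_iff algebra_simps
        add_divide_distrib diff_divide_distrib)
  finally have "J p (l p v) = ?\<rho> *\<^sub>t l p v" .
  moreover have "l p v \<in> tangent_space \<A> p"
    unfolding proj_l_lincomb by (intro tangent_space_lincomb J_tangent assms)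
  ultimately show ?thesis by (simp add: dist_L_def eigendistribution_def)
qed

lemma proj_l_section:
  assumes "X \<in> VF"
  shows "l \<bullet>\<^sub>T X \<in> \<Gamma>L"
proof -
  have "l \<bullet>\<^sub>T X \<in> VF"
    using vector_fields_lincomb[OF atlas J_vector_field[OF assms] assms]
    by (simp only: proj_l_lincomb apply_tensor_def)
  moreover have "(l \<bullet>\<^sub>T X) p \<in> L p" for p
    using assms proj_l_in_L by (simp add: apply_tensor_def vector_fields_def)
  ultimately show ?thesis by (simp add: sections_def)
qed

section \<open>Sections of the first eigendistribution\<close>

lemma section_vector_field: "X \<in> \<Gamma>L \<Longrightarrow> X \<in> VF"
  by (simp add: sections_def)

lemma J_on_section: "X \<in> \<Gamma>L \<Longrightarrow> J p (X p) = metallic_mean a b *\<^sub>t X p"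
  by (simp add: sections_def dist_L_def eigendistribution_def)

lemma proj_l_on_section: "X \<in> \<Gamma>L \<Longrightarrow> l \<bullet>\<^sub>T X = X"
  using metallic_mean_eigenvalue_gap[OF b_pos, of a]
  by (simp add: apply_tensor_def proj_l_lincomb J_on_section scale_tvec_def fun_eq_iff
      divide_simps) (simp add: algebra_simps)

lemma proj_m_on_section: "X \<in> \<Gamma>L \<Longrightarrow> m \<bullet>\<^sub>T X = 0"
  by (simp add: apply_tensor_def proj_m_def Let_def J_on_section scale_tvec_def fun_eq_iff)

lemma section_lincomb:
  assumes "X \<in> \<Gamma>L" "Y \<in> \<Gamma>L"
  shows "(\<lambda>p. c *\<^sub>t X p + d *\<^sub>t Y p) \<in> \<Gamma>L"
proof -
  have XY: "X p \<in> tangent_space \<A> p" "Y p \<in> tangent_space \<A> p" for p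
    using assms by (simp_all add: sections_def vector_fields_def)
  have "J p (c *\<^sub>t X p + d *\<^sub>t Y p) = metallic_mean a b *\<^sub>t (c *\<^sub>t X p + d *\<^sub>t Y p)" for p
    unfolding J_lincomb[OF XY] J_on_section[OF assms(1)] J_on_section[OF assms(2)]
    by (simp add: scale_tvec_def fun_eq_iff algebra_simps)
  then show ?thesis
    using vector_fields_lincomb[OF atlas section_vector_field section_vector_field, OF assms]
      tangent_space_lincomb[OF XY]
    by (simp add: sections_def dist_L_def eigendistribution_def)
qed

lemma section_add: "X \<in> \<Gamma>L \<Longrightarrow> Y \<in> \<Gamma>L \<Longrightarrow> X + Y \<in> \<Gamma>L"
  using section_lincomb[of X Y 1 1] by (simp add: scale_tvec_def plus_fun_def)

lemma section_diff: "X \<in> \<Gamma>L \<Longrightarrow> Y \<in> \<Gamma>L \<Longrightarrow> X - Y \<in> \<Gamma>L"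
  using section_lincomb[of X Y 1 "-1"] by (simp add: scale_tvec_def plus_fun_def fun_diff_def)

lemma zero_section: "X \<in> \<Gamma>L \<Longrightarrow> 0 \<in> \<Gamma>L"
  using section_diff[of X X] by simp

lemma section_uminus: "X \<in> \<Gamma>L \<Longrightarrow> - X \<in> \<Gamma>L"
  using section_diff[OF zero_section, of X X] by simp

lemma J_section:
  assumes "X \<in> \<Gamma>L"
  shows "J \<bullet>\<^sub>T X \<in> \<Gamma>L"
  using section_lincomb[OF assms assms, of "metallic_mean a b" 0]
  by (simp add: apply_tensor_def J_on_section[OF assms] scale_tvec_def plus_fun_def)

section \<open>The Vranceanu connection along the first eigendistribution\<close>

context
  fixes D :: "'a vfield \<Rightarrow> 'a vfield \<Rightarrow> 'a vfield" and X Y :: "'a vfield"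
  assumes connection: "linear_connection \<A> D"
    and X: "X \<in> \<Gamma>L"
    and Y: "Y \<in> VF"
    and bracket: "lie_bracket (l \<bullet>\<^sub>T X) (m \<bullet>\<^sub>T Y) \<in> \<Gamma>L"
begin

lemma connection_vector_field: "U \<in> VF \<Longrightarrow> V \<in> VF \<Longrightarrow> D U V \<in> VF"
  using connection unfolding linear_connection_def by blast

lemma bracket_section: "lie_bracket X (m \<bullet>\<^sub>T Y) \<in> \<Gamma>L"
  using bracket by (simp add: proj_l_on_section[OF X])

text \<open>Here the hypothesis on brackets is essential: it annihilates \<open>m [X, m Y]\<close>, the only surviving summand
  with values in \<open>M\<close>.\<close>

lemma vranceanu_along_section: "vranceanu a b J D X Y \<in> \<Gamma>L"
proof -
  have lY: "l \<bullet>\<^sub>T Y \<in> VF"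
    by (intro section_vector_field proj_l_section Y)
  have "D 0 (m \<bullet>\<^sub>T Y) = 0"
    using linear_connection_zero(1)[OF connection section_vector_field[OF zero_section[OF X]]]
      proj_m_vector_field[OF Y] .
  then have "vranceanu a b J D X Y = l \<bullet>\<^sub>T D X (l \<bullet>\<^sub>T Y)"
    using zero_section[OF X]
    by (simp add: vranceanu_def Let_def proj_l_on_section[OF X] proj_m_on_section[OF X]
        proj_m_on_section[OF bracket_section] lie_bracket_zero_left[OF lY]
        proj_l_on_section proj_m_on_section)
  then show ?thesis
    by (simp add: proj_l_section connection_vector_field section_vector_field[OF X] lY)
qed

text \<open>Both surviving summands are values of \<open>l\<close>. The bracket hypothesis enters only to make \<open>[m Y, X]\<close> a smooth vector field.\<close>

lemma vranceanu_of_section: "vranceanu a b J D Y X \<in> \<Gamma>L"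
proof -
  have lY: "l \<bullet>\<^sub>T Y \<in> VF"
    by (intro section_vector_field proj_l_section Y)
  have "D (m \<bullet>\<^sub>T Y) 0 = 0"
    using linear_connection_zero(2)[OF connection section_vector_field[OF zero_section[OF X]]]
      proj_m_vector_field[OF Y] .
  moreover have "lie_bracket (l \<bullet>\<^sub>T Y) 0 = 0"
    by (subst lie_bracket_anticommute) (simp add: lie_bracket_zero_left[OF lY])
  ultimately have *: "vranceanu a b J D Y X
      = l \<bullet>\<^sub>T D (l \<bullet>\<^sub>T Y) X + l \<bullet>\<^sub>T lie_bracket (m \<bullet>\<^sub>T Y) X"
    using zero_section[OF X]
    by (simp add: vranceanu_def Let_def proj_l_on_section[OF X] proj_m_on_section[OF X]
        proj_m_on_section)
  have "lie_bracket (m \<bullet>\<^sub>T Y) X \<in> \<Gamma>L"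
    by (subst lie_bracket_anticommute) (rule section_uminus[OF bracket_section])
  then show ?thesis
    unfolding *
    by (intro section_add proj_l_section connection_vector_field section_vector_field[OF X] lY
        section_vector_field)
qed

end

end

theorem proposition16:
  fixes \<A> :: "('a::{t2_space, second_countable_topology}, 'n::finite) atlas"
    and a b :: nat
    and J :: "'a tensor11"
    and D :: "'a vfield \<Rightarrow> 'a vfield \<Rightarrow> 'a vfield"
  assumes "smooth_atlas \<A>"
    and "a > 0" and "b > 0"
    and "metallic_structure \<A> a b J"
    and "linear_connection \<A> D"
    and "\<And>X Y. X \<in> sections \<A> (dist_L \<A> a b J) \<Longrightarrow> Y \<in> vector_fields \<A> \<Longrightarrow>
           lie_bracket (proj_l a b J \<bullet>\<^sub>T X) (proj_m a b J \<bullet>\<^sub>T Y) \<in> sections \<A> (dist_L \<A> a b J)"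
  shows "half_parallel \<A> J (vranceanu a b J D) (dist_L \<A> a b J)"
proof -
  interpret metallic_manifold \<A> a b J
    using assms by unfold_locales
  show ?thesis
    unfolding half_parallel_def Delta_def
  proof (intro ballI)
    fix X Y assume X: "X \<in> \<Gamma>L" and Y: "Y \<in> VF"
    have along: "vranceanu a b J D Z Y \<in> \<Gamma>L" and of: "vranceanu a b J D Y Z \<in> \<Gamma>L"
      if "Z \<in> \<Gamma>L" for Z
      using vranceanu_along_section vranceanu_of_section assms(5,6) that Y by blast+
    show "J \<bullet>\<^sub>T vranceanu a b J D X Y - J \<bullet>\<^sub>T vranceanu a b J D Y X
        - vranceanu a b J D (J \<bullet>\<^sub>T X) Y + vranceanu a b J D Y (J \<bullet>\<^sub>T X) \<in> \<Gamma>L"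
      by (intro section_add section_diff J_section along of X)
  qed
qed

end
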